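(* Let $M,N\in\Omega$. If $M\le N$, then $\sigma(M)\le\sigma(N)$; but if $\sigma(M)>\sigma(N)$, then the inequality $M(a,b)\le N(a,b)$ cannot hold, at least when $a/b$ is sufficiently large.
   Context: A mean is a map $M:\mathbb R_+\times\mathbb R_+\to\mathbb R_+$ (with $\mathbb R_+=(0,\infty)$) such that $\min(a,b)\le M(a,b)\le\max(a,b)$ for all $a,b\in\mathbb R_+$. $\Omega$ is the class of means that are symmetric in the variables $a,b$, reflexive ($M(a,a)=a$) and homogeneous of order one. $M\le N$ means $M(a,b)\le N(a,b)$ for all $a,b\in\mathbb R_+$. Let $A(a,b)=\frac{a+b}{2}$. For an arbitrary homogeneous and symmetric mean $M$, the characteristic number of $M$ is $$\sigma(M):=\lim_{a/b\to\infty}\frac{M(a,b)}{A(a,b)}=M(2,0^+)=M(0^+,2),$$ where, by homogeneity, the quotient $M(a,b)/A(a,b)$ depends only on $a/b$.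
   Formalization: The limits defining σ(M) and σ(N) are assumed to exist; this is not automatic for members of Ω, e.g. for min+(max−min)(1+sin(max/min))/2 the limit does not exist and σ is undefined. *)

theory Defs
  imports Complex_Main
begin

text \<open>
  Means are functions on the open positive quadrant. They are modelled as total functions
  on \<^typ>\<open>real\<close>; their values at arguments that are not both positive are irrelevant
  everywhere below.
\<close>

definition is_mean :: "(real \<Rightarrow> real \<Rightarrow> real) \<Rightarrow> bool" where
  "is_mean M \<longleftrightarrow>
     (\<forall>a>0. \<forall>b>0. 0 < M a b \<and> min a b \<le> M a b \<and> M a b \<le> max a b)"

definition symmetric_mean :: "(real \<Rightarrow> real \<Rightarrow> real) \<Rightarrow> bool" where
  "symmetric_mean M \<longleftrightarrow> (\<forall>a>0. \<forall>b>0. M a b = M b a)"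

definition reflexive_mean :: "(real \<Rightarrow> real \<Rightarrow> real) \<Rightarrow> bool" where
  "reflexive_mean M \<longleftrightarrow> (\<forall>a>0. M a a = a)"

definition homogeneous_mean :: "(real \<Rightarrow> real \<Rightarrow> real) \<Rightarrow> bool" where
  "homogeneous_mean M \<longleftrightarrow> (\<forall>t>0. \<forall>a>0. \<forall>b>0. M (t * a) (t * b) = t * M a b)"

definition Omega :: "(real \<Rightarrow> real \<Rightarrow> real) set" where
  "Omega = {M. is_mean M \<and> symmetric_mean M \<and> reflexive_mean M \<and> homogeneous_mean M}"

definition mean_le :: "(real \<Rightarrow> real \<Rightarrow> real) \<Rightarrow> (real \<Rightarrow> real \<Rightarrow> real) \<Rightarrow> bool" where
  "mean_le M N \<longleftrightarrow> (\<forall>a>0. \<forall>b>0. M a b \<le> N a b)"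

definition arith_mean :: "real \<Rightarrow> real \<Rightarrow> real" where
  "arith_mean a b = (a + b) / 2"

text \<open>The filter of pairs \<open>(a, b)\<close> with \<open>a, b > 0\<close> and \<open>a / b \<rightarrow> \<infinity>\<close>.\<close>

definition ratio_at_top :: "(real \<times> real) filter" where
  "ratio_at_top = inf (filtercomap (\<lambda>(a, b). a / b) at_top) (principal ({0<..} \<times> {0<..}))"

text \<open>
  Membership in \<^const>\<open>Omega\<close> does not force the limit defining the characteristic number
  to exist (no continuity is required of a mean), and \<^const>\<open>Lim\<close> is unspecified if it does
  not. Hence the separate existence predicate.
\<close>

definition has_characteristic_number :: "(real \<Rightarrow> real \<Rightarrow> real) \<Rightarrow> bool" where
  "has_characteristic_number M \<longleftrightarrow>
     (\<exists>L. ((\<lambda>(a, b). M a b / arith_mean a b) \<longlongrightarrow> L) ratio_at_top)"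

definition characteristic_number :: "(real \<Rightarrow> real \<Rightarrow> real) \<Rightarrow> real" where
  "characteristic_number M = Lim ratio_at_top (\<lambda>(a, b). M a b / arith_mean a b)"

lemma eventually_ratio_at_top:
  "eventually P ratio_at_top \<longleftrightarrow> (\<exists>K. \<forall>a>0. \<forall>b>0. K < a / b \<longrightarrow> P (a, b))"
proof
  assume "eventually P ratio_at_top"
  then obtain Q where Q: "eventually Q (at_top :: real filter)"
    and QP: "\<And>x. Q (case x of (a, b) \<Rightarrow> a / b) \<Longrightarrow> x \<in> {0<..} \<times> {0<..} \<longrightarrow> P x"
    unfolding ratio_at_top_def eventually_inf_principal eventually_filtercomap by blast
  from Q obtain K where K: "\<And>x. K < x \<Longrightarrow> Q x"
    unfolding eventually_at_top_dense by blast
  have "P (a, b)" if "0 < a" "0 < b" "K < a / b" for a b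
    using QP[of "(a, b)"] K[of "a / b"] that by simp
  then show "\<exists>K. \<forall>a>0. \<forall>b>0. K < a / b \<longrightarrow> P (a, b)"
    by blast
next
  assume "\<exists>K. \<forall>a>0. \<forall>b>0. K < a / b \<longrightarrow> P (a, b)"
  then obtain K where K: "\<And>a b. 0 < a \<Longrightarrow> 0 < b \<Longrightarrow> K < a / b \<Longrightarrow> P (a, b)"
    by blast
  have "eventually (\<lambda>x. K < x) (at_top :: real filter)"
    by (rule eventually_gt_at_top)
  moreover have "\<forall>x. K < (case x of (a, b) \<Rightarrow> a / b) \<longrightarrow> x \<in> {0<..} \<times> {0<..} \<longrightarrow> P x"
    using K by auto
  ultimately show "eventually P ratio_at_top"
    unfolding ratio_at_top_def eventually_inf_principal eventually_filtercomap by blast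
qed

lemma ratio_at_top_neq_bot: "ratio_at_top \<noteq> bot"
proof
  assume "ratio_at_top = bot"
  then have "eventually (\<lambda>_. False) ratio_at_top"
    by simp
  then obtain K :: real where K: "\<And>a b. 0 < a \<Longrightarrow> 0 < b \<Longrightarrow> K < a / b \<Longrightarrow> False"
    unfolding eventually_ratio_at_top by blast
  have "0 < \<bar>K\<bar> + 1" "K < \<bar>K\<bar> + 1"
    by linarith+
  with K[of "\<bar>K\<bar> + 1" 1] show False
    by simp
qed

lemma tendsto_characteristic_number:
  assumes "has_characteristic_number M"
  shows "((\<lambda>(a, b). M a b / arith_mean a b) \<longlongrightarrow> characteristic_number M) ratio_at_top"
  using assms tendsto_Lim[OF ratio_at_top_neq_bot]
  unfolding has_characteristic_number_def characteristic_number_def by metis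

text \<open>The alternative descriptions \<open>M(2, 0\<^sup>+)\<close> and \<open>M(0\<^sup>+, 2)\<close> of the same number.\<close>

lemma characteristic_number_right:
  assumes "has_characteristic_number M"
  shows "(M 2 \<longlongrightarrow> characteristic_number M) (at_right 0)"
proof -
  have "filterlim (\<lambda>x. (2, x)) ratio_at_top (at_right (0::real))"
    unfolding filterlim_iff eventually_ratio_at_top
  proof (intro allI impI, elim exE)
    fix P :: "real \<times> real \<Rightarrow> bool" and K :: real
    assume P: "\<forall>a>0. \<forall>b>0. K < a / b \<longrightarrow> P (a, b)"
    have "P (2, x)" if "0 < x" "x < 2 / (\<bar>K\<bar> + 1)" for x
    proof -
      have "x * (\<bar>K\<bar> + 1) < 2"
        using that by (simp add: field_simps)
      moreover have "K * x \<le> x * \<bar>K\<bar>"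
        using that by (simp add: mult.commute mult_left_mono)
      ultimately have "K * x < 2"
        using that(1) unfolding distrib_left by linarith
      then have "K < 2 / x"
        using that(1) by (simp add: pos_less_divide_eq)
      with P that show ?thesis
        by simp
    qed
    moreover have "0 < 2 / (\<bar>K\<bar> + 1)"
      by simp
    ultimately show "eventually (\<lambda>x. P (2, x)) (at_right 0)"
      unfolding eventually_at_right_field by blast
  qed
  from filterlim_compose[OF tendsto_characteristic_number[OF assms] this]
  have "((\<lambda>x. M 2 x / arith_mean 2 x) \<longlongrightarrow> characteristic_number M) (at_right 0)"
    by simp
  moreover have "(arith_mean 2 \<longlongrightarrow> (2 + 0) / 2) (at_right 0)"
    unfolding arith_mean_def[abs_def] by (intro tendsto_intros) auto
  ultimately have "((\<lambda>x. M 2 x / arith_mean 2 x * arith_mean 2 x) \<longlongrightarrow>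
      characteristic_number M * ((2 + 0) / 2)) (at_right 0)"
    by (rule tendsto_mult)
  moreover have "eventually (\<lambda>x. M 2 x / arith_mean 2 x * arith_mean 2 x = M 2 x) (at_right 0)"
    unfolding eventually_at_right_field
    by (intro exI[where x = 1]) (auto simp: arith_mean_def)
  ultimately show ?thesis
    by (auto elim: Lim_transform_eventually)
qed

lemma characteristic_number_left:
  assumes "has_characteristic_number M" "symmetric_mean M"
  shows "((\<lambda>x. M x 2) \<longlongrightarrow> characteristic_number M) (at_right 0)"
proof (rule Lim_transform_eventually[OF characteristic_number_right[OF assms(1)]])
  show "eventually (\<lambda>x. M 2 x = M x 2) (at_right 0)"
    unfolding eventually_at_right_field
    using assms(2) by (intro exI[where x = 1]) (auto simp: symmetric_mean_def)
qed

end

theory Submission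
  imports Defs
begin

text \<open>The quotients of \<open>M\<close> and \<open>N\<close> by \<open>arith_mean\<close>
  converge along \<open>ratio_at_top\<close>, so a strict gap between their limits forces the same
  strict order on the quotients once a / b is large. Clearing the common positive denominator gives
  \<open>N a b < M a b\<close> there, which is the second claim. The first follows by contradiction,
  since pairs of arbitrarily large ratio exist.\<close>

lemma eventually_less_of_characteristic_number_less:
  assumes "has_characteristic_number M" "has_characteristic_number N"
    and "characteristic_number N < characteristic_number M"
  shows "\<forall>\<^sub>F (a, b) in ratio_at_top. N a b < M a b"
proof -
  \<comment> \<open>A value strictly between the limits separates the two quotients
    eventually.\<close>
  obtain c where c: "characteristic_number N < c" "c < characteristic_number M"
    using dense[OF assms(3)] by blast
  have "\<forall>\<^sub>F (a, b) in ratio_at_top. N a b / arith_mean a b < c"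
    using order_tendstoD(2)[OF tendsto_characteristic_number[OF assms(2)] c(1)]
    by (simp add: case_prod_unfold)
  moreover have "\<forall>\<^sub>F (a, b) in ratio_at_top. c < M a b / arith_mean a b"
    using order_tendstoD(1)[OF tendsto_characteristic_number[OF assms(1)] c(2)]
    by (simp add: case_prod_unfold)
  \<comment> \<open>The filter only sees positive pairs; this positivity lets the denominator be
    cancelled below.\<close>
  moreover have "\<forall>\<^sub>F (a, b) in ratio_at_top. 0 < arith_mean a b"
    unfolding eventually_ratio_at_top by (simp add: arith_mean_def)
  ultimately show ?thesis
  proof eventually_elim
    case (elim p)
    obtain a b where p: "p = (a, b)"
      by force
    have "N a b / arith_mean a b < M a b / arith_mean a b"
      using elim unfolding p by simp
    then show ?case
      using elim(3) unfolding p by (simp add: divide_less_cancel)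
  qed
qed

theorem theorem2p0:
  fixes M N :: "real \<Rightarrow> real \<Rightarrow> real"
  assumes "M \<in> Omega" and "N \<in> Omega"
    and "has_characteristic_number M" and "has_characteristic_number N"
  shows "(mean_le M N \<longrightarrow> characteristic_number M \<le> characteristic_number N) \<and>
         (characteristic_number M > characteristic_number N \<longrightarrow>
            (\<exists>K. \<forall>a>0. \<forall>b>0. a / b > K \<longrightarrow> \<not> M a b \<le> N a b))"
proof (intro conjI impI)
  assume gt: "characteristic_number M > characteristic_number N"
  \<comment> \<open>\<open>K\<close> is the threshold hidden in the eventual inequality.\<close>
  show "\<exists>K. \<forall>a>0. \<forall>b>0. a / b > K \<longrightarrow> \<not> M a b \<le> N a b"
    using eventually_less_of_characteristic_number_less[OF assms(3,4) gt]
    unfolding eventually_ratio_at_top by (simp add: not_le)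
next
  assume le: "mean_le M N"
  show "characteristic_number M \<le> characteristic_number N"
  proof (rule ccontr)
    assume "\<not> characteristic_number M \<le> characteristic_number N"
    then have "\<forall>\<^sub>F (a, b) in ratio_at_top. N a b < M a b"
      using eventually_less_of_characteristic_number_less[OF assms(3,4)] by simp
    moreover have "\<forall>\<^sub>F (a, b) in ratio_at_top. M a b \<le> N a b"
      using le unfolding eventually_ratio_at_top mean_le_def by simp
    \<comment> \<open>Opposite inequalities both hold eventually, which is impossible along a proper
      filter.\<close>
    ultimately have "\<forall>\<^sub>F p in ratio_at_top. False"
      by eventually_elim auto
    then show False
      using ratio_at_top_neq_bot by simp
  qed
qed

end
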